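(* Let $S$ be an intra-regular LA-semigroup with left identity and let $A$ be a nonempty subset of $S$. Then the following conditions are equivalent: (i) $A$ is a $(1,2)$-ideal of $S$; (ii) $A$ is a two-sided ideal of $S$.
   Context: An LA-semigroup (left almost semigroup) is a nonempty set $S$ with a binary operation, written as juxtaposition, satisfying the left invertive law $(ab)c=(cb)a$ for all $a,b,c\in S$ (associativity and commutativity are not assumed). A left identity is an element $e\in S$ with $ea=a$ for all $a\in S$. For subsets $A,B\subseteq S$, $AB=\{ab: a\in A,\ b\in B\}$ and $A^2=AA$. A nonempty subset $A\subseteq S$ is a two-sided ideal if $SA\subseteq A$ and $AS\subseteq A$. A nonempty subset $A\subseteq S$ is an LA-subsemigroup if $A^2\subseteq A$; an LA-subsemigroup $A$ is a $(1,2)$-ideal if $(AS)A^{2}\subseteq A$. $S$ is intra-regular if for every $a\in S$ there exist $x,y\in S$ such that $a=(xa^{2})y$, where $a^2=aa$. *)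

theory Defs
  imports Main
begin

locale la_semigroup =
  fixes S :: "'a set" and mult :: "'a \<Rightarrow> 'a \<Rightarrow> 'a" (infixl \<open>\<cdot>\<close> 70)
  assumes nonempty: "S \<noteq> {}"
    and closed: "a \<in> S \<Longrightarrow> b \<in> S \<Longrightarrow> a \<cdot> b \<in> S"
    and left_invertive:
      "a \<in> S \<Longrightarrow> b \<in> S \<Longrightarrow> c \<in> S \<Longrightarrow> (a \<cdot> b) \<cdot> c = (c \<cdot> b) \<cdot> a"

definition left_identity :: "'a set \<Rightarrow> ('a \<Rightarrow> 'a \<Rightarrow> 'a) \<Rightarrow> 'a \<Rightarrow> bool" where
  "left_identity S mult e \<longleftrightarrow> e \<in> S \<and> (\<forall>a\<in>S. mult e a = a)"

definition set_prod :: "('a \<Rightarrow> 'a \<Rightarrow> 'a) \<Rightarrow> 'a set \<Rightarrow> 'a set \<Rightarrow> 'a set" where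
  "set_prod mult A B = {mult a b |a b. a \<in> A \<and> b \<in> B}"

definition two_sided_ideal :: "'a set \<Rightarrow> ('a \<Rightarrow> 'a \<Rightarrow> 'a) \<Rightarrow> 'a set \<Rightarrow> bool" where
  "two_sided_ideal S mult A \<longleftrightarrow>
     A \<noteq> {} \<and> A \<subseteq> S \<and> set_prod mult S A \<subseteq> A \<and> set_prod mult A S \<subseteq> A"

definition la_subsemigroup :: "'a set \<Rightarrow> ('a \<Rightarrow> 'a \<Rightarrow> 'a) \<Rightarrow> 'a set \<Rightarrow> bool" where
  "la_subsemigroup S mult A \<longleftrightarrow> A \<noteq> {} \<and> A \<subseteq> S \<and> set_prod mult A A \<subseteq> A"

definition one_two_ideal :: "'a set \<Rightarrow> ('a \<Rightarrow> 'a \<Rightarrow> 'a) \<Rightarrow> 'a set \<Rightarrow> bool" where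
  "one_two_ideal S mult A \<longleftrightarrow>
     la_subsemigroup S mult A \<and>
     set_prod mult (set_prod mult A S) (set_prod mult A A) \<subseteq> A"

definition intra_regular :: "'a set \<Rightarrow> ('a \<Rightarrow> 'a \<Rightarrow> 'a) \<Rightarrow> bool" where
  "intra_regular S mult \<longleftrightarrow>
     (\<forall>a\<in>S. \<exists>x\<in>S. \<exists>y\<in>S. a = mult (mult x (mult a a)) y)"

end

theory Submission
  imports Defs
begin

text \<open>
  The point is that intra-regularity with a left identity upgrades \<open>a = (x a\<^sup>2) y\<close> to
  \<open>a = w a\<^sup>2\<close>. Since \<open>s (w b)\<close> always has the form \<open>v b\<close>, every left multiple \<open>s a\<close> is then a
  left multiple of \<open>a\<^sup>2\<close>, and squaring \<open>a = w a\<^sup>2\<close> makes it a left multiple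
  \<open>v (a\<^sup>2 a\<^sup>2)\<close>. This last element equals \<open>(a\<^sup>2 v) a\<^sup>2\<close>, so \<open>S a \<subseteq> (a\<^sup>2 S) a\<^sup>2\<close>. If \<open>A\<close> is
  a \<open>(1,2)\<close>-ideal containing \<open>a\<close>, then \<open>a\<^sup>2 \<in> A\<close> and the right-hand side lies in \<open>(A S) A\<^sup>2 \<subseteq> A\<close>;
  hence \<open>A\<close> is a left ideal. On the right, \<open>a s = (u a) a\<close> for some \<open>u\<close>, a product of two
  elements of \<open>A\<close> because \<open>u a \<in> A\<close> is already known.

  The converse is a matter of absorption: a product whose left factor
  lies in a two-sided ideal stays in the ideal, so \<open>A A\<close>, \<open>A S\<close> and \<open>(A S) A\<^sup>2\<close> all lie in \<open>A\<close>.
\<close>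

lemma set_prod_subset_iff: "set_prod mult A B \<subseteq> C \<longleftrightarrow> (\<forall>a\<in>A. \<forall>b\<in>B. mult a b \<in> C)"
  unfolding set_prod_def by blast

lemma ball_set_prod: "(\<forall>x\<in>set_prod mult A B. P x) \<longleftrightarrow> (\<forall>a\<in>A. \<forall>b\<in>B. P (mult a b))"
  unfolding set_prod_def by blast

context la_semigroup
begin

lemma medial:
  assumes "a \<in> S" "b \<in> S" "c \<in> S" "d \<in> S"
  shows "(a \<cdot> b) \<cdot> (c \<cdot> d) = (a \<cdot> c) \<cdot> (b \<cdot> d)"
proof -
  have "(a \<cdot> b) \<cdot> (c \<cdot> d) = ((c \<cdot> d) \<cdot> b) \<cdot> a"
    using assms by (intro left_invertive closed)
  also have "(c \<cdot> d) \<cdot> b = (b \<cdot> d) \<cdot> c"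
    using assms by (intro left_invertive)
  also have "((b \<cdot> d) \<cdot> c) \<cdot> a = (a \<cdot> c) \<cdot> (b \<cdot> d)"
    using assms by (intro left_invertive closed)
  finally show ?thesis .
qed

lemma left_commute_of_left_identity:
  assumes "left_identity S mult e" "a \<in> S" "b \<in> S" "c \<in> S"
  shows "a \<cdot> (b \<cdot> c) = b \<cdot> (a \<cdot> c)"
  using medial[of e a b c] assms by (simp add: left_identity_def)

lemma paramedial_of_left_identity:
  assumes e: "left_identity S mult e" and S: "a \<in> S" "b \<in> S" "c \<in> S" "d \<in> S"
  shows "(a \<cdot> b) \<cdot> (c \<cdot> d) = (d \<cdot> c) \<cdot> (b \<cdot> a)"
proof -
  have "(a \<cdot> b) \<cdot> (c \<cdot> d) = c \<cdot> ((a \<cdot> b) \<cdot> d)"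
    using S by (intro left_commute_of_left_identity[OF e] closed)
  also have "(a \<cdot> b) \<cdot> d = (d \<cdot> b) \<cdot> a"
    using S by (intro left_invertive)
  also have "c \<cdot> ((d \<cdot> b) \<cdot> a) = (d \<cdot> b) \<cdot> (c \<cdot> a)"
    using S by (intro left_commute_of_left_identity[OF e] closed)
  also have "\<dots> = (d \<cdot> c) \<cdot> (b \<cdot> a)"
    using S by (intro medial)
  finally show ?thesis .
qed

text \<open>
  Two successive left multiplications amount to a single one, although the operation is
  not associative: the factor \<open>s w\<close> has to be replaced by \<open>(s e) w\<close>.
\<close>

lemma left_mult_left_mult:
  assumes e: "left_identity S mult e" and S: "s \<in> S" "w \<in> S" "b \<in> S"
  shows "s \<cdot> (w \<cdot> b) = ((s \<cdot> e) \<cdot> w) \<cdot> b"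
proof -
  have eS: "e \<in> S" and "e \<cdot> s = s"
    using e S by (auto simp: left_identity_def)
  then have "s \<cdot> (w \<cdot> b) = (e \<cdot> s) \<cdot> (w \<cdot> b)"
    by simp
  also have "\<dots> = (b \<cdot> w) \<cdot> (s \<cdot> e)"
    using S eS by (intro paramedial_of_left_identity[OF e])
  also have "\<dots> = ((s \<cdot> e) \<cdot> w) \<cdot> b"
    using S eS by (intro left_invertive closed)
  finally show ?thesis .
qed

text \<open>
  The outer factor \<open>y\<close> in \<open>a = (x a\<^sup>2) y\<close> can be moved inside: the paramedial law turns
  \<open>x a\<^sup>2\<close> into \<open>a\<^sup>2 (x e)\<close>, and the left invertive law then exchanges \<open>a\<^sup>2\<close> and \<open>y\<close>.
\<close>

lemma intra_regular_left_multiple_of_square: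
  assumes e: "left_identity S mult e" and reg: "intra_regular S mult" and a: "a \<in> S"
  obtains w where "w \<in> S" "a = w \<cdot> (a \<cdot> a)"
proof -
  obtain x y where S: "x \<in> S" "y \<in> S" and axy: "a = (x \<cdot> (a \<cdot> a)) \<cdot> y"
    using reg a unfolding intra_regular_def by blast
  have eS: "e \<in> S" and "e \<cdot> x = x"
    using e S by (auto simp: left_identity_def)
  then have outer: "x \<cdot> (a \<cdot> a) = (a \<cdot> a) \<cdot> (x \<cdot> e)"
    using paramedial_of_left_identity[OF e eS S(1) a a] by simp
  have "a = ((a \<cdot> a) \<cdot> (x \<cdot> e)) \<cdot> y"
    by (fact axy[unfolded outer])
  also have "\<dots> = (y \<cdot> (x \<cdot> e)) \<cdot> (a \<cdot> a)"
    using S a eS by (intro left_invertive closed)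
  finally show thesis
    using that S eS closed by blast
qed

text \<open>
  The factor \<open>a\<^sup>2\<close> has to appear twice, once to give \<open>(a\<^sup>2 v)\<close> and once as the right factor. The
  second copy comes from squaring \<open>a = w a\<^sup>2\<close>, which by the medial law reads
  \<open>a\<^sup>2 = (w w) (a\<^sup>2 a\<^sup>2)\<close>.
\<close>

lemma left_multiple_in_square_sandwich:
  assumes e: "left_identity S mult e" and reg: "intra_regular S mult"
    and a: "a \<in> S" and s: "s \<in> S"
  obtains v where "v \<in> S" "s \<cdot> a = ((a \<cdot> a) \<cdot> v) \<cdot> (a \<cdot> a)"
proof -
  obtain w where w: "w \<in> S" and aw: "a = w \<cdot> (a \<cdot> a)"
    using intra_regular_left_multiple_of_square[OF e reg a] .
  have eS: "e \<in> S"
    using e by (simp add: left_identity_def)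
  define b where "b = a \<cdot> a"
  have b: "b \<in> S"
    using a closed by (simp add: b_def)
  define t where "t = (s \<cdot> e) \<cdot> w"
  define v where "v = (t \<cdot> e) \<cdot> (w \<cdot> w)"
  have t: "t \<in> S" and v: "v \<in> S"
    using s w eS closed by (simp_all add: t_def v_def)
  have ab: "a = w \<cdot> b"
    using aw by (simp add: b_def)
  have "b = (w \<cdot> b) \<cdot> (w \<cdot> b)"
    using ab b_def by metis
  also have "\<dots> = (w \<cdot> w) \<cdot> (b \<cdot> b)"
    using w b by (intro medial)
  finally have bb: "b = (w \<cdot> w) \<cdot> (b \<cdot> b)" .
  have "s \<cdot> a = s \<cdot> (w \<cdot> b)"
    using ab by simp
  also have "\<dots> = t \<cdot> b"
    unfolding t_def using s w b by (intro left_mult_left_mult[OF e])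
  also have "\<dots> = t \<cdot> ((w \<cdot> w) \<cdot> (b \<cdot> b))"
    by (simp flip: bb)
  also have "\<dots> = v \<cdot> (b \<cdot> b)"
    unfolding v_def using t w b by (intro left_mult_left_mult[OF e] closed)
  (* The paramedial law needs a left factor that is visibly a product, so one copy of b is
     brought to the front and unfolded to a a. *)
  also have "\<dots> = b \<cdot> (v \<cdot> b)"
    using v b by (intro left_commute_of_left_identity[OF e])
  also have "\<dots> = (a \<cdot> a) \<cdot> (v \<cdot> b)"
    by (simp only: b_def)
  also have "\<dots> = (b \<cdot> v) \<cdot> (a \<cdot> a)"
    using a v b by (intro paramedial_of_left_identity[OF e])
  finally show thesis
    using that v by (simp add: b_def)
qed

text \<open>
  Substituting \<open>a = w a\<^sup>2\<close> puts \<open>a s\<close> into the form \<open>a\<^sup>2 z\<close>, and the left invertive law turns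
  \<open>(a a) z\<close> into \<open>(z a) a\<close>.
\<close>

lemma right_multiple_as_left_multiple:
  assumes e: "left_identity S mult e" and reg: "intra_regular S mult"
    and a: "a \<in> S" and s: "s \<in> S"
  obtains u where "u \<in> S" "a \<cdot> s = (u \<cdot> a) \<cdot> a"
proof -
  obtain w where w: "w \<in> S" and aw: "a = w \<cdot> (a \<cdot> a)"
    using intra_regular_left_multiple_of_square[OF e reg a] .
  have eS: "e \<in> S" and ew: "e \<cdot> w = w"
    using e w by (auto simp: left_identity_def)
  have "a \<cdot> s = (w \<cdot> (a \<cdot> a)) \<cdot> s"
    by (simp flip: aw)
  also have "\<dots> = (s \<cdot> (a \<cdot> a)) \<cdot> (e \<cdot> w)"
    using left_invertive[of w "a \<cdot> a" s] w a s closed by (simp add: ew)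
  also have "\<dots> = (w \<cdot> e) \<cdot> ((a \<cdot> a) \<cdot> s)"
    using s a eS w by (intro paramedial_of_left_identity[OF e] closed)
  also have "\<dots> = (a \<cdot> a) \<cdot> ((w \<cdot> e) \<cdot> s)"
    using s a eS w by (intro left_commute_of_left_identity[OF e] closed)
  also have "\<dots> = (((w \<cdot> e) \<cdot> s) \<cdot> a) \<cdot> a"
    using s a eS w by (intro left_invertive closed)
  finally show thesis
    using that s eS w closed by blast
qed

lemma one_two_ideal_imp_two_sided_ideal:
  assumes e: "left_identity S mult e" and reg: "intra_regular S mult"
    and A: "one_two_ideal S mult A"
  shows "two_sided_ideal S mult A"
proof -
  have sub: "A \<noteq> {}" "A \<subseteq> S"
    and AA: "\<And>a b. a \<in> A \<Longrightarrow> b \<in> A \<Longrightarrow> a \<cdot> b \<in> A"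
    and ASAA: "\<And>a s b c. \<lbrakk>a \<in> A; s \<in> S; b \<in> A; c \<in> A\<rbrakk> \<Longrightarrow> (a \<cdot> s) \<cdot> (b \<cdot> c) \<in> A"
    using A unfolding one_two_ideal_def la_subsemigroup_def set_prod_subset_iff ball_set_prod
    by simp_all
  have SA: "s \<cdot> a \<in> A" if s: "s \<in> S" and a: "a \<in> A" for s a
  proof -
    obtain v where "v \<in> S" "s \<cdot> a = ((a \<cdot> a) \<cdot> v) \<cdot> (a \<cdot> a)"
      using left_multiple_in_square_sandwich[OF e reg subsetD[OF sub(2) a] s] .
    then show ?thesis
      using ASAA AA a by simp
  qed
  have AS: "a \<cdot> s \<in> A" if s: "s \<in> S" and a: "a \<in> A" for s a
  proof -
    obtain u where "u \<in> S" "a \<cdot> s = (u \<cdot> a) \<cdot> a"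
      using right_multiple_as_left_multiple[OF e reg subsetD[OF sub(2) a] s] .
    then show ?thesis
      using SA AA a by simp
  qed
  show ?thesis
    using sub SA AS by (simp add: two_sided_ideal_def set_prod_subset_iff)
qed

end

lemma two_sided_ideal_imp_one_two_ideal:
  assumes "two_sided_ideal S mult A"
  shows "one_two_ideal S mult A"
proof -
  have sub: "A \<noteq> {}" "A \<subseteq> S"
    and AS: "\<And>a s. \<lbrakk>a \<in> A; s \<in> S\<rbrakk> \<Longrightarrow> mult a s \<in> A"
    using assms by (simp_all add: two_sided_ideal_def set_prod_subset_iff)
  then have AA: "mult a b \<in> A" if "a \<in> A" "b \<in> A" for a b
    using that by (meson subsetD)
  have "set_prod mult A A \<subseteq> A" and "set_prod mult (set_prod mult A S) (set_prod mult A A) \<subseteq> A"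
    using AS AA sub by (simp_all add: set_prod_subset_iff ball_set_prod)
  then show ?thesis
    using sub by (simp add: one_two_ideal_def la_subsemigroup_def)
qed

theorem theorem12:
  fixes S :: "'a set" and mult :: "'a \<Rightarrow> 'a \<Rightarrow> 'a" and A :: "'a set"
  assumes "la_semigroup S mult"
    and "\<exists>e. left_identity S mult e"
    and "intra_regular S mult"
    and "A \<subseteq> S" and "A \<noteq> {}"
  shows "one_two_ideal S mult A \<longleftrightarrow> two_sided_ideal S mult A"
  using la_semigroup.one_two_ideal_imp_two_sided_ideal assms(1-3)
    two_sided_ideal_imp_one_two_ideal by metis

end
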